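(* Let $\{\phi_t\}_{t\ge0}$ be a one-parameter semigroup of analytic self-maps of the unit disk $\mathbb{D}$ consisting of rotations or dilations of $\mathbb{D}$. Then $A=[\phi_t,H^\infty]$, where $A$ is the disk algebra.
   Context: $\mathbb{D}=\{z\in\mathbb{C}:|z|<1\}$, $H(\mathbb{D})$ is the set of analytic functions on $\mathbb{D}$, and $H^\infty$ is the space of bounded functions in $H(\mathbb{D})$ with norm $\|f\|_\infty=\sup_{z\in\mathbb{D}}|f(z)|$. The disk algebra $A$ is the subspace of $H^\infty$ consisting of functions that extend to be continuous on $\overline{\mathbb{D}}$. A one-parameter semigroup $\{\phi_t\}_{t\ge0}$ of analytic functions on $\mathbb{D}$ is a family of analytic functions $\phi_t:\mathbb{D}\to\mathbb{D}$ such that: $\phi_0(z)=z$ for $z\in\mathbb{D}$; $\phi_{s+t}=\phi_s\circ\phi_t$ for all $s,t\ge0$; and $(t,z)\mapsto\phi_t(z)$ is continuous on $[0,\infty)\times\mathbb{D}$. The semigroup consists of rotations if $\phi_t(z)=e^{iat}z$ for some real $a\ne0$; it consists of dilations if $\phi_t(z)=e^{-ct}z$ for some $c\in\mathbb{C}$ with $\mathrm{Re}\,c>0$. Put $C_t(f)=f\circ\phi_t$. $[\phi_t,H^\infty]$ denotes the maximal closed subspace of $H^\infty$ on which $\{C_t\}$ is strongly continuous, i.e. on which $\lim_{t\to0^+}\|f\circ\phi_t-f\|_\infty=0$ for every element $f$. *)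

theory Defs
  imports
    "HOL-Analysis.Analysis"
    "HOL-Complex_Analysis.Complex_Analysis"
    "HOL-Library.Function_Algebras"
begin

abbreviation disc :: "complex set" where
  "disc \<equiv> ball 0 1"

text \<open>Functions on the disc are total functions normalised to vanish off the disc, so that
  equality of functions is equality on the disc and the sup norm is a genuine norm.\<close>

definition H_infty :: "(complex \<Rightarrow> complex) set" where
  "H_infty = {f. f holomorphic_on disc \<and> bounded (f ` disc) \<and> (\<forall>z. z \<notin> disc \<longrightarrow> f z = 0)}"

definition sup_norm :: "(complex \<Rightarrow> complex) \<Rightarrow> real" where
  "sup_norm f = (SUP z\<in>disc. norm (f z))"

definition disc_algebra :: "(complex \<Rightarrow> complex) set" where
  "disc_algebra =
    {f \<in> H_infty. \<exists>g. continuous_on (cball 0 1) g \<and> (\<forall>z\<in>disc. g z = f z)}"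

text \<open>Only the parameters \<open>t \<ge> 0\<close> and the values of \<open>\<phi> t\<close> on the disc matter.\<close>

definition disc_semigroup :: "(real \<Rightarrow> complex \<Rightarrow> complex) \<Rightarrow> bool" where
  "disc_semigroup \<phi> \<longleftrightarrow>
    (\<forall>t\<ge>0. \<phi> t holomorphic_on disc \<and> \<phi> t ` disc \<subseteq> disc) \<and>
    (\<forall>z\<in>disc. \<phi> 0 z = z) \<and>
    (\<forall>s\<ge>0. \<forall>t\<ge>0. \<forall>z\<in>disc. \<phi> (s + t) z = \<phi> s (\<phi> t z)) \<and>
    continuous_on ({0..} \<times> disc) (\<lambda>(t, z). \<phi> t z)"

definition consists_of_rotations :: "(real \<Rightarrow> complex \<Rightarrow> complex) \<Rightarrow> bool" where
  "consists_of_rotations \<phi> \<longleftrightarrow>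
    (\<exists>a::real. a \<noteq> 0 \<and> (\<forall>t\<ge>0. \<forall>z\<in>disc. \<phi> t z = exp (\<i> * of_real a * of_real t) * z))"

definition consists_of_dilations :: "(real \<Rightarrow> complex \<Rightarrow> complex) \<Rightarrow> bool" where
  "consists_of_dilations \<phi> \<longleftrightarrow>
    (\<exists>c::complex. Re c > 0 \<and> (\<forall>t\<ge>0. \<forall>z\<in>disc. \<phi> t z = exp (- c * of_real t) * z))"

definition comp_op :: "(real \<Rightarrow> complex \<Rightarrow> complex) \<Rightarrow> real \<Rightarrow> (complex \<Rightarrow> complex) \<Rightarrow> complex \<Rightarrow> complex" where
  "comp_op \<phi> t f = (\<lambda>z. if z \<in> disc then f (\<phi> t z) else 0)"

definition strongly_continuous_on ::
    "(real \<Rightarrow> complex \<Rightarrow> complex) \<Rightarrow> (complex \<Rightarrow> complex) set \<Rightarrow> bool" where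
  "strongly_continuous_on \<phi> X \<longleftrightarrow>
    (\<forall>f\<in>X. ((\<lambda>t. sup_norm (comp_op \<phi> t f - f)) \<longlongrightarrow> 0) (at_right 0))"

global_interpretation cfun: vector_space "\<lambda>(c::complex) (f::complex \<Rightarrow> complex) z. c * f z"
  by unfold_locales (auto simp: fun_eq_iff algebra_simps)

lemma bdd_above_H_infty:
  assumes "f \<in> H_infty"
  shows "bdd_above ((\<lambda>z. norm (f z)) ` disc)"
  using assms unfolding H_infty_def bounded_iff bdd_above_def by auto

lemma norm_le_sup_norm:
  assumes "f \<in> H_infty"
  shows "norm (f z) \<le> sup_norm f"
proof (cases "z \<in> disc")
  case True
  then show ?thesis
    unfolding sup_norm_def using bdd_above_H_infty[OF assms] by (rule cSUP_upper)
next
  case False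
  have "0 \<le> norm (f 0)" by simp
  also have "\<dots> \<le> sup_norm f"
    unfolding sup_norm_def using bdd_above_H_infty[OF assms] by (intro cSUP_upper) auto
  finally show ?thesis using False assms by (auto simp: H_infty_def)
qed

lemma sup_norm_le:
  assumes "\<And>z. z \<in> disc \<Longrightarrow> norm (f z) \<le> B"
  shows "sup_norm f \<le> B"
  unfolding sup_norm_def using assms by (intro cSUP_least) auto

lemma subspace_H_infty: "cfun.subspace H_infty"
proof (rule cfun.subspaceI)
  show "0 \<in> H_infty" by (auto simp: H_infty_def zero_fun_def bounded_iff)
next
  fix f g assume "f \<in> H_infty" "g \<in> H_infty"
  then show "f + g \<in> H_infty"
    by (auto simp: H_infty_def plus_fun_def intro: holomorphic_on_add bounded_plus_comp)
next
  fix c f assume "f \<in> H_infty"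
  then show "(\<lambda>z. c * f z) \<in> H_infty"
    by (auto simp: H_infty_def bounded_iff norm_mult intro!: holomorphic_on_mult)
       (metis mult_left_mono norm_ge_zero)
qed

lemmas diff_H_infty = cfun.subspace_diff[OF subspace_H_infty]

text \<open>The case distinction is there because \<^locale>\<open>Metric_space\<close> requires a distance that is
  nonnegative everywhere, whereas the supremum of an unbounded set of reals is unspecified.\<close>

definition H_infty_dist :: "(complex \<Rightarrow> complex) \<Rightarrow> (complex \<Rightarrow> complex) \<Rightarrow> real" where
  "H_infty_dist f g = (if f \<in> H_infty \<and> g \<in> H_infty then sup_norm (f - g) else 0)"

global_interpretation H_infty: Metric_space H_infty H_infty_dist
proof
  fix f g :: "complex \<Rightarrow> complex"
  show "0 \<le> H_infty_dist f g"
    using norm_le_sup_norm[OF diff_H_infty[of f g], of 0]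
    by (auto simp: H_infty_dist_def intro: order_trans[OF norm_ge_zero])
  show "H_infty_dist f g = H_infty_dist g f"
    by (simp add: H_infty_dist_def sup_norm_def norm_minus_commute)
next
  fix f g assume fg: "f \<in> H_infty" "g \<in> H_infty"
  show "H_infty_dist f g = 0 \<longleftrightarrow> f = g"
  proof
    assume "H_infty_dist f g = 0"
    then have "norm ((f - g) z) \<le> 0" for z
      using fg norm_le_sup_norm[OF diff_H_infty[OF fg], of z] by (simp add: H_infty_dist_def)
    then show "f = g" by (auto simp: fun_eq_iff)
  next
    assume "f = g"
    then show "H_infty_dist f g = 0" by (simp add: H_infty_dist_def sup_norm_def)
  qed
next
  fix f g h assume fgh: "f \<in> H_infty" "g \<in> H_infty" "h \<in> H_infty"
  have "sup_norm (f - h) \<le> sup_norm (f - g) + sup_norm (g - h)"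
  proof (rule sup_norm_le)
    fix z
    have "norm ((f - h) z) \<le> norm ((f - g) z) + norm ((g - h) z)"
      using norm_triangle_ineq[of "(f - g) z" "(g - h) z"] by simp
    also have "\<dots> \<le> sup_norm (f - g) + sup_norm (g - h)"
      using fgh by (intro add_mono norm_le_sup_norm diff_H_infty)
    finally show "norm ((f - h) z) \<le> sup_norm (f - g) + sup_norm (g - h)" .
  qed
  then show "H_infty_dist f h \<le> H_infty_dist f g + H_infty_dist g h"
    using fgh by (simp add: H_infty_dist_def)
qed

definition closed_subspace_H_infty :: "(complex \<Rightarrow> complex) set \<Rightarrow> bool" where
  "closed_subspace_H_infty X \<longleftrightarrow> cfun.subspace X \<and> closedin H_infty.mtopology X"

text \<open>\<^const>\<open>Greatest\<close> is taken with respect to inclusion; that the greatest subspace exists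
  for every semigroup is shown in \<open>max_subspace_greatest\<close> below.\<close>

definition max_subspace :: "(real \<Rightarrow> complex \<Rightarrow> complex) \<Rightarrow> (complex \<Rightarrow> complex) set" where
  "max_subspace \<phi> = (GREATEST X. closed_subspace_H_infty X \<and> strongly_continuous_on \<phi> X)"

lemma comp_op_H_infty:
  assumes "disc_semigroup \<phi>" "t \<ge> 0" "f \<in> H_infty"
  shows "comp_op \<phi> t f \<in> H_infty"
proof -
  have hol: "\<phi> t holomorphic_on disc" and sub: "\<phi> t ` disc \<subseteq> disc"
    using assms by (auto simp: disc_semigroup_def)
  have "(f \<circ> \<phi> t) holomorphic_on disc"
    using hol sub assms(3) by (auto simp: H_infty_def intro!: holomorphic_on_compose_gen)
  then have "comp_op \<phi> t f holomorphic_on disc"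
    by (rule holomorphic_transform) (simp add: comp_op_def)
  moreover have "bounded (comp_op \<phi> t f ` disc)"
    using norm_le_sup_norm[OF assms(3)]
    unfolding bounded_iff by (intro exI[of _ "sup_norm f"]) (auto simp: comp_op_def)
  ultimately show ?thesis by (simp add: H_infty_def comp_op_def)
qed

lemma sup_norm_comp_op_le:
  assumes "f \<in> H_infty"
  shows "sup_norm (comp_op \<phi> t f) \<le> sup_norm f"
  using norm_le_sup_norm[OF assms] by (intro sup_norm_le) (simp add: comp_op_def)

lemma sup_norm_nonneg: "f \<in> H_infty \<Longrightarrow> 0 \<le> sup_norm f"
  using norm_le_sup_norm[of f 0] norm_ge_zero order_trans by blast

lemma sup_norm_add_le:
  assumes "f \<in> H_infty" "g \<in> H_infty"
  shows "sup_norm (f + g) \<le> sup_norm f + sup_norm g"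
proof (rule sup_norm_le)
  fix z
  have "norm ((f + g) z) \<le> norm (f z) + norm (g z)" by (simp add: norm_triangle_ineq)
  also have "\<dots> \<le> sup_norm f + sup_norm g"
    using assms by (intro add_mono norm_le_sup_norm)
  finally show "norm ((f + g) z) \<le> sup_norm f + sup_norm g" .
qed

lemma strong_continuity_set:
  assumes \<phi>: "disc_semigroup \<phi>"
  defines "S \<equiv> {f \<in> H_infty. ((\<lambda>t. sup_norm (comp_op \<phi> t f - f)) \<longlongrightarrow> 0) (at_right 0)}"
  shows "closed_subspace_H_infty S"
proof -
  have cH: "comp_op \<phi> t f - f \<in> H_infty" if "f \<in> H_infty" "t \<ge> 0" for f t
    using that comp_op_H_infty[OF \<phi>] diff_H_infty by blast
  have pos: "\<forall>\<^sub>F t::real in at_right 0. 0 \<le> t"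
    by (auto simp: eventually_at_right_less intro: eventually_mono[OF eventually_at_right_less])
  have sub: "cfun.subspace S"
  proof (rule cfun.subspaceI)
    have "comp_op \<phi> t 0 - 0 = 0" for t by (auto simp: comp_op_def fun_eq_iff)
    moreover have "sup_norm 0 = 0" by (simp add: sup_norm_def)
    ultimately show "0 \<in> S" using cfun.subspace_0[OF subspace_H_infty] by (simp add: S_def)
  next
    fix f g assume fg: "f \<in> S" "g \<in> S"
    then have H: "f \<in> H_infty" "g \<in> H_infty" by (auto simp: S_def)
    have lim: "((\<lambda>t. sup_norm (comp_op \<phi> t f - f) + sup_norm (comp_op \<phi> t g - g)) \<longlongrightarrow> 0) (at_right 0)"
      using fg tendsto_add[where a=0 and b="0::real"] by (fastforce simp: S_def)
    have eq: "comp_op \<phi> t (f + g) - (f + g) = (comp_op \<phi> t f - f) + (comp_op \<phi> t g - g)" for t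
      by (auto simp: comp_op_def fun_eq_iff)
    have fgH: "f + g \<in> H_infty" using cfun.subspace_add[OF subspace_H_infty H] .
    have "((\<lambda>t. sup_norm (comp_op \<phi> t (f + g) - (f + g))) \<longlongrightarrow> 0) (at_right 0)"
    proof (rule tendsto_sandwich[OF _ _ tendsto_const lim])
      show "\<forall>\<^sub>F t in at_right 0. 0 \<le> sup_norm (comp_op \<phi> t (f + g) - (f + g))"
        using pos by eventually_elim (intro sup_norm_nonneg cH fgH)
      show "\<forall>\<^sub>F t in at_right 0. sup_norm (comp_op \<phi> t (f + g) - (f + g))
          \<le> sup_norm (comp_op \<phi> t f - f) + sup_norm (comp_op \<phi> t g - g)"
        using pos unfolding eq by eventually_elim (intro sup_norm_add_le cH H)
    qed
    then show "f + g \<in> S" using fgH by (simp add: S_def)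
  next
    fix c f assume f: "f \<in> S"
    then have H: "f \<in> H_infty" by (auto simp: S_def)
    let ?g = "\<lambda>z. c * f z"
    have gH: "?g \<in> H_infty" using cfun.subspace_scale[OF subspace_H_infty H] .
    have lim: "((\<lambda>t. norm c * sup_norm (comp_op \<phi> t f - f)) \<longlongrightarrow> 0) (at_right 0)"
      using f by (auto simp: S_def intro!: tendsto_mult_right_zero)
    have "((\<lambda>t. sup_norm (comp_op \<phi> t ?g - ?g)) \<longlongrightarrow> 0) (at_right 0)"
    proof (rule tendsto_sandwich[OF _ _ tendsto_const lim])
      show "\<forall>\<^sub>F t in at_right 0. 0 \<le> sup_norm (comp_op \<phi> t ?g - ?g)"
        using pos by eventually_elim (intro sup_norm_nonneg cH gH)
      show "\<forall>\<^sub>F t in at_right 0. sup_norm (comp_op \<phi> t ?g - ?g) \<le> norm c * sup_norm (comp_op \<phi> t f - f)"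
        using pos
      proof eventually_elim
        case (elim t)
        show ?case
        proof (rule sup_norm_le)
          fix z :: complex assume "z \<in> disc"
          then have "(comp_op \<phi> t ?g - ?g) z = c * (comp_op \<phi> t f - f) z"
            by (simp add: comp_op_def algebra_simps)
          then have "norm ((comp_op \<phi> t ?g - ?g) z) = norm c * norm ((comp_op \<phi> t f - f) z)"
            by (simp add: norm_mult)
          then show "norm ((comp_op \<phi> t ?g - ?g) z) \<le> norm c * sup_norm (comp_op \<phi> t f - f)"
            using norm_le_sup_norm[OF cH[OF H elim], of z] by (simp add: mult_left_mono)
        qed
      qed
    qed
    then show "?g \<in> S" using gH by (simp add: S_def)
  qed
  moreover have "closedin H_infty.mtopology S"
  proof (subst H_infty.metric_closedin_iff_sequentially_closed, intro conjI allI impI)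
    show "S \<subseteq> H_infty" by (auto simp: S_def)
  next
    fix \<sigma> l assume "range \<sigma> \<subseteq> S \<and> limitin H_infty.mtopology \<sigma> l sequentially"
    then have \<sigma>: "\<And>n. \<sigma> n \<in> S" and l: "limitin H_infty.mtopology \<sigma> l sequentially" by auto
    have lH: "l \<in> H_infty" using l by (simp add: H_infty.limitin_metric)
    have "((\<lambda>t. sup_norm (comp_op \<phi> t l - l)) \<longlongrightarrow> 0) (at_right 0)"
    proof (rule tendstoI)
      fix e :: real assume e: "e > 0"
      obtain n where n: "H_infty_dist (\<sigma> n) l < e / 3"
        using l e unfolding H_infty.limitin_metric eventually_sequentially
        by (metis order_refl zero_less_divide_iff zero_less_numeral)
      define g where "g = \<sigma> n"
      have gS: "g \<in> S" using \<sigma> by (simp add: g_def)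
      then have gH: "g \<in> H_infty" by (simp add: S_def)
      have lg: "sup_norm (l - g) < e / 3"
        using n gH lH H_infty.commute[of g l] by (simp add: H_infty_dist_def g_def)
      have gl: "sup_norm (g - l) < e / 3"
        using n gH lH by (simp add: H_infty_dist_def g_def)
      have "\<forall>\<^sub>F t in at_right 0. dist (sup_norm (comp_op \<phi> t g - g)) 0 < e / 3"
        using gS e by (intro tendstoD) (auto simp: S_def)
      then show "\<forall>\<^sub>F t in at_right 0. dist (sup_norm (comp_op \<phi> t l - l)) 0 < e"
        using pos
      proof eventually_elim
        case (elim t)
        have eq: "comp_op \<phi> t l - l = comp_op \<phi> t (l - g) + ((comp_op \<phi> t g - g) + (g - l))"
          by (auto simp: comp_op_def fun_eq_iff)
        have "sup_norm (comp_op \<phi> t l - l)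
            \<le> sup_norm (comp_op \<phi> t (l - g)) + sup_norm ((comp_op \<phi> t g - g) + (g - l))"
          unfolding eq
          by (intro sup_norm_add_le comp_op_H_infty[OF \<phi>] elim diff_H_infty lH gH cH
              cfun.subspace_add[OF subspace_H_infty])
        also have "\<dots> \<le> sup_norm (l - g) + (sup_norm (comp_op \<phi> t g - g) + sup_norm (g - l))"
          by (intro add_mono sup_norm_comp_op_le sup_norm_add_le diff_H_infty lH gH cH elim)
        also have "\<dots> < e"
          using lg gl elim by (simp add: dist_real_def)
        finally show ?case
          using sup_norm_nonneg[OF cH[OF lH elim(2)]] by (simp add: dist_real_def)
      qed
    qed
    then show "l \<in> S" using lH by (simp add: S_def)
  qed
  ultimately show ?thesis by (simp add: closed_subspace_H_infty_def)
qed

lemma max_subspace_greatest: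
  assumes "disc_semigroup \<phi>"
  shows "closed_subspace_H_infty (max_subspace \<phi>)"
    and "strongly_continuous_on \<phi> (max_subspace \<phi>)"
    and "closed_subspace_H_infty X \<Longrightarrow> strongly_continuous_on \<phi> X \<Longrightarrow> X \<subseteq> max_subspace \<phi>"
proof -
  define S where "S = {f \<in> H_infty. ((\<lambda>t. sup_norm (comp_op \<phi> t f - f)) \<longlongrightarrow> 0) (at_right 0)}"
  have S: "closed_subspace_H_infty S" "strongly_continuous_on \<phi> S"
    using strong_continuity_set[OF assms] by (auto simp: S_def strongly_continuous_on_def)
  have le: "X \<subseteq> S" if "closed_subspace_H_infty X" "strongly_continuous_on \<phi> X" for X
    using that closedin_subset[of H_infty.mtopology X]
    by (auto simp: S_def closed_subspace_H_infty_def strongly_continuous_on_def)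
  have eq: "max_subspace \<phi> = S"
    unfolding max_subspace_def using S le by (intro Greatest_equality) auto
  show "closed_subspace_H_infty (max_subspace \<phi>)" "strongly_continuous_on \<phi> (max_subspace \<phi>)"
    using S by (simp_all add: eq)
  show "X \<subseteq> max_subspace \<phi>" if "closed_subspace_H_infty X" "strongly_continuous_on \<phi> X"
    using le that by (simp add: eq)
qed

end

theory Submission
  imports Defs
begin

text \<open>In both cases \<open>\<phi>\<^sub>t(z) = e\<^bsup>\<mu>t\<^esup> z\<close> with \<open>\<mu> \<noteq> 0\<close> and \<open>Re \<mu> \<le> 0\<close>, so \<open>\<phi>\<^sub>t\<close> tends to the identity
  uniformly on the disc, and a uniformly continuous \<open>f\<close> satisfies \<open>f \<circ> \<phi>\<^sub>t \<longlongrightarrow> f\<close> uniformly.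
  Conversely, let \<open>G\<close> be a primitive of \<open>(f(z) - f(0)) / z\<close>, which is bounded, so that \<open>G\<close> is
  Lipschitz on the disc. The time derivative of \<open>G(\<phi>\<^sub>t(z))\<close> is \<open>\<mu> (f(\<phi>\<^sub>t(z)) - f(0))\<close>; hence, if
  \<open>f \<circ> \<phi>\<^sub>t \<longlongrightarrow> f\<close> uniformly, then \<open>f - f(0)\<close> is the uniform limit of the Lipschitz functions
  \<open>(G \<circ> \<phi>\<^sub>t - G) / (\<mu>t)\<close>, so \<open>f\<close> is uniformly continuous and extends to the closed disc.\<close>

text \<open>The Schwarz lemma, rescaled. The two bounds serve to control the difference quotient of
  \<open>f\<close> at 0, away from 0 and at 0.\<close>

lemma norm_diff_at_0_le:
  assumes hol: "f holomorphic_on disc" and B: "\<And>z. z \<in> disc \<Longrightarrow> norm (f z) \<le> B"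
    and z: "z \<in> disc"
  shows "norm (f z - f 0) \<le> (2 * B + 1) * norm z"
    and "norm (deriv f 0) \<le> 2 * B + 1"
proof -
  \<comment> \<open>\<open>2 * B\<close> bounds \<open>f z - f 0\<close>; the extra 1 keeps the
    divisor nonzero when \<open>B = 0\<close> and makes \<open>norm (h w) < 1\<close> strict, as the
    Schwarz lemma demands.\<close>
  define c where "c = complex_of_real (2 * B + 1)"
  define h where "h = (\<lambda>z. (f z - f 0) / c)"
  have B0: "B \<ge> 0"
    using order_trans[OF norm_ge_zero B[of 0]] by simp
  then have nc: "norm c = 2 * B + 1" and c0: "c \<noteq> 0"
    unfolding c_def norm_of_real of_real_eq_0_iff by auto
  have h_hol: "h holomorphic_on disc"
    unfolding h_def using hol c0 by (intro holomorphic_intros) auto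
  have h_less: "norm (h w) < 1" if "norm w < 1" for w
  proof -
    have "norm (f w - f 0) \<le> norm (f w) + norm (f 0)" by (rule norm_triangle_ineq4)
    also have "\<dots> < 2 * B + 1" using B[of w] B[of 0] that by simp
    finally show ?thesis using nc B0 by (simp add: h_def norm_divide)
  qed
  have "h 0 = 0" by (simp add: h_def)
  note sch = Schwarz_Lemma[OF h_hol this h_less]
  have "norm (h z) \<le> norm z" using sch(1) z by simp
  then show "norm (f z - f 0) \<le> (2 * B + 1) * norm z"
    using nc B0 by (simp add: h_def norm_divide field_simps)
  have "(f has_field_derivative deriv f 0) (at 0)"
    using hol by (intro holomorphic_derivI[where S = disc]) auto
  then have "(h has_field_derivative deriv f 0 / c) (at 0)"
    unfolding h_def by (auto intro!: derivative_eq_intros simp: c0)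
  then have "deriv h 0 = deriv f 0 / c" by (rule DERIV_imp_deriv)
  moreover have "norm (deriv h 0) \<le> 1" using sch(2)[of 0] by simp
  ultimately show "norm (deriv f 0) \<le> 2 * B + 1"
    using nc B0 by (simp add: norm_divide field_simps)
qed

text \<open>The difference quotient of \<open>f\<close> at 0 has a removable singularity and is
  bounded, so its primitive on the convex disc is Lipschitz.\<close>

lemma radial_primitive_Lipschitz:
  assumes hol: "f holomorphic_on disc" and bdd: "bounded (f ` disc)"
  obtains G G' L where
    "\<And>z. z \<in> disc \<Longrightarrow> (G has_field_derivative G' z) (at z)"
    "\<And>z. z \<in> disc \<Longrightarrow> z * G' z = f z - f 0"
    "\<And>x y. x \<in> disc \<Longrightarrow> y \<in> disc \<Longrightarrow> norm (G x - G y) \<le> L * norm (x - y)"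
proof -
  obtain B where B: "\<And>z. z \<in> disc \<Longrightarrow> norm (f z) \<le> B"
    using bdd unfolding bounded_iff by (meson imageI)
  define q where "q = (\<lambda>z. if z = 0 then deriv f 0 else (f z - f 0) / (z - 0))"
  have "q holomorphic_on disc"
    unfolding q_def using hol by (intro pole_lemma_open) auto
  then obtain G where G: "\<And>z. z \<in> disc \<Longrightarrow> (G has_field_derivative q z) (at z within disc)"
    using holomorphic_convex_primitive'[of disc q] by auto
  have q: "norm (q z) \<le> 2 * B + 1" if "z \<in> disc" for z
    using norm_diff_at_0_le[OF hol B that] by (auto simp: q_def norm_divide field_simps)
  show ?thesis
  proof (rule that)
    show "(G has_field_derivative q z) (at z)" if "z \<in> disc" for z
      using G[OF that] that by (simp add: at_within_open[of _ disc])
    show "z * q z = f z - f 0" if "z \<in> disc" for z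
      by (simp add: q_def)
    show "norm (G x - G y) \<le> (2 * B + 1) * norm (x - y)" if "x \<in> disc" "y \<in> disc" for x y
      using field_differentiable_bound[OF convex_ball G q that] .
  qed
qed

lemma norm_exp_le_1:
  assumes "Re \<mu> \<le> 0" "t \<ge> 0"
  shows "norm (exp (\<mu> * of_real t)) \<le> 1"
  using assms by (simp add: mult_nonpos_nonneg)

lemma exp_mult_in_disc:
  assumes "Re \<mu> \<le> 0" "t \<ge> 0" "z \<in> disc"
  shows "exp (\<mu> * of_real t) * z \<in> disc"
proof -
  have "norm (exp (\<mu> * of_real t)) * norm z \<le> 1 * norm z"
    using norm_exp_le_1[OF assms(1,2)] by (intro mult_right_mono) auto
  then show ?thesis
    using assms(3) unfolding mem_ball_0 norm_mult by linarith
qed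

text \<open>For each \<open>e\<close> a single time \<open>t\<close> suffices: the Lipschitz
  function \<open>F\<close>, divided by \<open>t * \<mu>\<close>, stays within \<open>e / 4\<close>
  of \<open>f - f 0\<close> on the whole disc.\<close>

lemma uniformly_continuous_on_disc_if_flow:
  assumes hol: "f holomorphic_on disc" and bdd: "bounded (f ` disc)"
    and \<mu>: "\<mu> \<noteq> 0" "Re \<mu> \<le> 0"
    and lim: "\<And>e. e > 0 \<Longrightarrow>
      \<exists>t>0. \<forall>s\<in>{0..t}. \<forall>z\<in>disc. norm (f (exp (\<mu> * of_real s) * z) - f z) \<le> e"
  shows "uniformly_continuous_on disc f"
  unfolding uniformly_continuous_on_def
proof (intro allI impI)
  fix e :: real assume e: "e > 0"
  obtain G G' L
    where G: "\<And>z. z \<in> disc \<Longrightarrow> (G has_field_derivative G' z) (at z)"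
      and G': "\<And>z. z \<in> disc \<Longrightarrow> z * G' z = f z - f 0"
      and L: "\<And>x y. x \<in> disc \<Longrightarrow> y \<in> disc \<Longrightarrow> norm (G x - G y) \<le> L * norm (x - y)"
    using radial_primitive_Lipschitz[OF hol bdd] by blast
  \<comment> \<open>Any two distinct points of the disc force this; 0 and 1/2 are taken.\<close>
  have L0: "L \<ge> 0"
    using order_trans[OF norm_ge_zero L[of 0 "1/2"]] by (simp add: zero_le_mult_iff)
  obtain t where t: "t > 0"
    and close: "\<And>s z. s \<in> {0..t} \<Longrightarrow> z \<in> disc \<Longrightarrow>
      norm (f (exp (\<mu> * of_real s) * z) - f z) \<le> e / 4"
    using lim[of "e / 4"] e by auto
  define w where "w = exp (\<mu> * of_real t)"
  define F where "F = (\<lambda>z. G (w * z) - G z)"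
  have w: "norm w \<le> 1"
    unfolding w_def using \<mu> t by (intro norm_exp_le_1) auto
  have wD: "w * z \<in> disc" if "z \<in> disc" for z
    unfolding w_def using \<mu> t that by (intro exp_mult_in_disc) auto
  \<comment> \<open>By the chain rule and \<open>G'\<close>, the curve \<open>G (?E s * z)\<close>
    has velocity \<open>?H' s\<close>. The choice of \<open>t\<close> keeps this velocity within
    \<open>norm \<mu> * (e / 4)\<close> of its initial value, so over \<open>{0..t}\<close> the
    curve is nearly linear.\<close>
  have approx: "norm (F z - of_real t * \<mu> * (f z - f 0)) \<le> t * norm \<mu> * (e / 4)"
    if z: "z \<in> disc" for z
  proof -
    let ?E = "\<lambda>s::real. exp (\<mu> * of_real s)"
    let ?H' = "\<lambda>s. \<mu> * (f (?E s * z) - f 0)"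
    have "((\<lambda>s. G (?E s * z)) has_vector_derivative ?H' s) (at s within {0..t})"
      if s: "s \<in> {0..t}" for s
    proof -
      have D: "?E s * z \<in> disc" using \<mu> s z by (intro exp_mult_in_disc) auto
      have "((\<lambda>s. ?E s * z) has_vector_derivative \<mu> * (?E s * z)) (at s within {0..t})"
        by (auto intro!: derivative_eq_intros has_vector_derivative_real_field)
      from field_vector_diff_chain_within[OF this has_field_derivative_at_within[OF G[OF D]]]
      show ?thesis using G'[OF D] by (simp add: o_def mult_ac)
    qed
    moreover have "norm (?H' s - ?H' 0) \<le> norm \<mu> * (e / 4)" if "s \<in> {0..t}" for s
    proof -
      have "?H' s - ?H' 0 = \<mu> * (f (?E s * z) - f z)" by (simp add: algebra_simps)
      then show ?thesis
        using mult_left_mono[OF close[OF that z], of "norm \<mu>"] by (simp add: norm_mult)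
    qed
    ultimately have "norm (G (?E t * z) - G (?E 0 * z) - (t - 0) *\<^sub>R ?H' 0)
        \<le> norm (t - 0) * (norm \<mu> * (e / 4))"
      using t by (intro vector_differentiable_bound_linearization[where S = "{0..t}"])
        (auto simp: closed_segment_eq_real_ivl)
    then show ?thesis
      using t by (simp add: F_def w_def scaleR_conv_of_real mult_ac)
  qed
  \<comment> \<open>Solves \<open>(L + 1) * d = t * norm \<mu> * (e / 4)\<close>; \<open>L\<close>
    itself might be 0. Of the four quarters of \<open>e\<close>, two are spent on
    \<open>F x - F y\<close> and one on each use of \<open>approx\<close>.\<close>
  define d where "d = t * norm \<mu> * (e / 4) / (L + 1)"
  have tm: "t * norm \<mu> > 0" using t \<mu> by simp
  have "d > 0" unfolding d_def using tm e L0 by simp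
  moreover have "dist (f x) (f y) < e" if x: "x \<in> disc" and y: "y \<in> disc" and xy: "dist x y < d" for x y
  proof -
    have "norm (F x - F y) \<le> norm (G (w * x) - G (w * y)) + norm (G x - G y)"
      unfolding F_def using norm_triangle_ineq4[of "G (w * x) - G (w * y)" "G x - G y"]
      by (simp add: algebra_simps)
    also have "\<dots> \<le> L * norm (w * x - w * y) + L * norm (x - y)"
      using x y wD by (intro add_mono L)
    \<comment> \<open>Multiplication by \<open>w\<close> does not expand distances, because
      \<open>Re \<mu> \<le> 0\<close>.\<close>
    also have "norm (w * x - w * y) \<le> norm (x - y)"
      using w mult_right_mono[OF w norm_ge_zero[of "x - y"]]
      by (simp add: norm_mult flip: right_diff_distrib)
    finally have "norm (F x - F y) \<le> 2 * ((L + 1) * norm (x - y))"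
      using L0 by (simp add: mult_left_mono distrib_right add_increasing2)
    also have "(L + 1) * norm (x - y) < (L + 1) * d"
      using xy L0 by (simp add: dist_norm)
    also have "(L + 1) * d = t * norm \<mu> * (e / 4)" using L0 unfolding d_def by (simp del: times_divide_eq_right add: mult.commute[of "L + 1"])
    finally have Fxy: "norm (F x - F y) < 2 * (t * norm \<mu> * (e / 4))" by simp
    have eq: "of_real t * \<mu> * (f x - f y)
      = (F x - F y) - (F x - of_real t * \<mu> * (f x - f 0)) + (F y - of_real t * \<mu> * (f y - f 0))"
      by (simp add: algebra_simps)
    have "norm (of_real t * \<mu> * (f x - f y)) \<le> norm (F x - F y)
        + norm (F x - of_real t * \<mu> * (f x - f 0)) + norm (F y - of_real t * \<mu> * (f y - f 0))"
      unfolding eq by (intro norm_triangle_le add_mono norm_triangle_ineq4 order_refl)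
    also have "\<dots> < 4 * (t * norm \<mu> * (e / 4))"
      using Fxy approx[OF x] approx[OF y] by linarith
    finally have "t * norm \<mu> * norm (f x - f y) < t * norm \<mu> * e"
      using t by (simp add: norm_mult)
    then show ?thesis using mult_less_cancel_left_pos[OF tm] by (simp only: dist_norm)
  qed
  ultimately show "\<exists>d>0. \<forall>x\<in>disc. \<forall>x'\<in>disc. dist x' x < d \<longrightarrow> dist (f x') (f x) < e"
    by blast
qed

text \<open>The displacement \<open>dist (\<phi> t z) z\<close> is at most
  \<open>norm (exp (\<mu> * of_real t) - 1)\<close>, uniformly in \<open>z\<close>, so one modulus
  of continuity serves for all \<open>z\<close>.\<close>

lemma flow_tendsto_if_uniformly_continuous_on_disc:
  assumes f: "f \<in> H_infty" and uc: "uniformly_continuous_on disc f"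
    and \<phi>: "disc_semigroup \<phi>" "\<And>t z. t \<ge> 0 \<Longrightarrow> z \<in> disc \<Longrightarrow> \<phi> t z = exp (\<mu> * of_real t) * z"
  shows "((\<lambda>t. sup_norm (comp_op \<phi> t f - f)) \<longlongrightarrow> 0) (at_right 0)"
proof (rule tendstoI)
  fix e :: real assume e: "e > 0"
  \<comment> \<open>Half of \<open>e\<close>, since passing to the supremum turns a strict bound
    into a weak one.\<close>
  obtain d where d: "d > 0"
    and f_close: "\<And>x y. x \<in> disc \<Longrightarrow> y \<in> disc \<Longrightarrow> dist y x < d \<Longrightarrow> dist (f y) (f x) < e / 2"
    using uc half_gt_zero[OF e] unfolding uniformly_continuous_on_def by meson
  have "((\<lambda>t. exp (\<mu> * of_real t)) \<longlongrightarrow> exp (\<mu> * of_real 0)) (at_right 0)"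
    by (intro tendsto_intros)
  then have "\<forall>\<^sub>F t in at_right 0. dist (exp (\<mu> * of_real t)) 1 < d"
    using d by (auto dest: tendstoD)
  then show "\<forall>\<^sub>F t in at_right 0. dist (sup_norm (comp_op \<phi> t f - f)) 0 < e"
    using eventually_at_right_less[of 0]
  proof eventually_elim
    case (elim t)
    then have t: "t \<ge> 0" by simp
    have "sup_norm (comp_op \<phi> t f - f) \<le> e / 2"
    proof (rule sup_norm_le)
      fix z :: complex assume z: "z \<in> disc"
      have "\<phi> t z \<in> disc" using \<phi>(1) t z by (meson disc_semigroup_def image_subset_iff)
      moreover have "dist (\<phi> t z) z < d"
      proof -
        have "dist (\<phi> t z) z = norm (exp (\<mu> * of_real t) - 1) * norm z"
          using \<phi>(2)[OF t z] by (simp add: dist_norm left_diff_distrib flip: norm_mult)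
        also have "\<dots> \<le> norm (exp (\<mu> * of_real t) - 1)"
          using z by (intro mult_left_le) auto
        finally show ?thesis using elim by (simp add: dist_norm)
      qed
      ultimately show "norm ((comp_op \<phi> t f - f) z) \<le> e / 2"
        using f_close[OF z, of "\<phi> t z"] z by (simp add: comp_op_def dist_norm)
    qed
    moreover have "0 \<le> sup_norm (comp_op \<phi> t f - f)"
      using \<phi>(1) t f by (intro sup_norm_nonneg diff_H_infty comp_op_H_infty)
    ultimately show ?case using e by (simp add: dist_real_def)
  qed
qed

lemma uniformly_continuous_on_disc_if_flow_tendsto:
  assumes f: "f \<in> H_infty" and \<mu>: "\<mu> \<noteq> 0" "Re \<mu> \<le> 0"
    and \<phi>: "disc_semigroup \<phi>" "\<And>t z. t \<ge> 0 \<Longrightarrow> z \<in> disc \<Longrightarrow> \<phi> t z = exp (\<mu> * of_real t) * z"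
    and lim: "((\<lambda>t. sup_norm (comp_op \<phi> t f - f)) \<longlongrightarrow> 0) (at_right 0)"
  shows "uniformly_continuous_on disc f"
proof (rule uniformly_continuous_on_disc_if_flow[OF _ _ \<mu>])
  show "f holomorphic_on disc" "bounded (f ` disc)" using f by (auto simp: H_infty_def)
  fix e :: real assume e: "e > 0"
  obtain b where b: "b > 0"
    and small: "\<And>s. 0 < s \<Longrightarrow> s < b \<Longrightarrow> dist (sup_norm (comp_op \<phi> s f - f)) 0 < e"
    using tendstoD[OF lim e] unfolding eventually_at_right_field by auto
  have "norm (f (exp (\<mu> * of_real s) * z) - f z) \<le> e" if s: "s \<in> {0..b / 2}" and z: "z \<in> disc" for s z
  \<comment> \<open>The limit at \<open>at_right 0\<close> says nothing about \<open>s = 0\<close>,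
    where the flow is the identity.\<close>
  proof (cases "s = 0")
    case False
    have "norm ((comp_op \<phi> s f - f) z) \<le> sup_norm (comp_op \<phi> s f - f)"
      using \<phi>(1) s f by (intro norm_le_sup_norm diff_H_infty comp_op_H_infty) auto
    also have "\<dots> \<le> e" using small[of s] s b False by (auto simp: dist_real_def)
    finally show ?thesis using \<phi>(2)[of s z] s z by (simp add: comp_op_def)
  qed (use e in simp)
  then show "\<exists>t>0. \<forall>s\<in>{0..t}. \<forall>z\<in>disc. norm (f (exp (\<mu> * of_real s) * z) - f z) \<le> e"
    using b by (intro exI[of _ "b / 2"]) auto
qed

text \<open>Heine-Cantor on the compact closed disc in one direction; in the other, a uniformly
  continuous map into a complete space extends to the closure.\<close>

lemma disc_algebra_iff_uniformly_continuous:
  "f \<in> disc_algebra \<longleftrightarrow> f \<in> H_infty \<and> uniformly_continuous_on disc f"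
proof (intro iffI conjI)
  assume "f \<in> disc_algebra"
  then obtain g where "f \<in> H_infty"
    and g: "continuous_on (cball 0 1) g" "\<And>z. z \<in> disc \<Longrightarrow> g z = f z"
    by (auto simp: disc_algebra_def)
  then show "f \<in> H_infty" by simp
  have "uniformly_continuous_on disc g"
    using compact_uniformly_continuous[OF g(1) compact_cball]
    unfolding uniformly_continuous_on_def
    by (elim all_forward imp_forward ex_forward conj_forward) auto
  then show "uniformly_continuous_on disc f"
    using g(2) by (simp add: uniformly_continuous_on_def)
next
  assume f: "f \<in> H_infty \<and> uniformly_continuous_on disc f"
  then obtain g where "uniformly_continuous_on (closure disc) g" "\<And>z. z \<in> disc \<Longrightarrow> f z = g z"
    using uniformly_continuous_on_extension_on_closure by metis
  then show "f \<in> disc_algebra"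
    using f by (auto simp: disc_algebra_def intro!: exI[of _ g] uniformly_continuous_imp_continuous)
qed

theorem proposition4p1:
  fixes \<phi> :: "real \<Rightarrow> complex \<Rightarrow> complex"
  assumes "disc_semigroup \<phi>"
    and "consists_of_rotations \<phi> \<or> consists_of_dilations \<phi>"
  shows "disc_algebra = max_subspace \<phi>"
proof -
  obtain \<mu> where \<mu>: "\<mu> \<noteq> 0" "Re \<mu> \<le> 0"
    and \<phi>: "\<And>t z. t \<ge> 0 \<Longrightarrow> z \<in> disc \<Longrightarrow> \<phi> t z = exp (\<mu> * of_real t) * z"
    using assms(2)
  proof
    assume "consists_of_rotations \<phi>"
    then obtain a :: real where "a \<noteq> 0"
      "\<And>t z. t \<ge> 0 \<Longrightarrow> z \<in> disc \<Longrightarrow> \<phi> t z = exp (\<i> * of_real a * of_real t) * z"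
      by (auto simp: consists_of_rotations_def)
    then show thesis by (intro that[of "\<i> * of_real a"]) auto
  next
    assume "consists_of_dilations \<phi>"
    then obtain c :: complex where "Re c > 0"
      "\<And>t z. t \<ge> 0 \<Longrightarrow> z \<in> disc \<Longrightarrow> \<phi> t z = exp (- c * of_real t) * z"
      by (auto simp: consists_of_dilations_def)
    then show thesis by (intro that[of "- c"]) auto
  qed
  \<comment> \<open>\<open>?S\<close> collects every function with the required limit and is itself
    a closed subspace, so it is the maximal one.\<close>
  let ?S = "{f \<in> H_infty. ((\<lambda>t. sup_norm (comp_op \<phi> t f - f)) \<longlongrightarrow> 0) (at_right 0)}"
  have "?S \<subseteq> max_subspace \<phi>"
    using assms(1) by (intro max_subspace_greatest(3) strong_continuity_set)
      (auto simp: strongly_continuous_on_def)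
  moreover have "max_subspace \<phi> \<subseteq> ?S"
    using max_subspace_greatest(1,2)[OF assms(1)] closedin_subset[of H_infty.mtopology "max_subspace \<phi>"]
    by (auto simp: closed_subspace_H_infty_def strongly_continuous_on_def)
  moreover have "disc_algebra = ?S"
    using flow_tendsto_if_uniformly_continuous_on_disc[OF _ _ assms(1) \<phi>]
      uniformly_continuous_on_disc_if_flow_tendsto[OF _ \<mu> assms(1) \<phi>]
    by (auto simp: disc_algebra_iff_uniformly_continuous)
  ultimately show ?thesis by simp
qed

end
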